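(* Every dyadic space of cardinality greater than $\mathfrak{c}=2^{\aleph_0}$ is destructible.
   Context: A Hausdorff space is dyadic if it is a continuous image of the Cantor cube $2^\kappa$ (product of $\kappa$ copies of the two-point discrete space) for some infinite cardinal $\kappa$. A forcing notion $\mathbb P$ is countably closed if every decreasing sequence in $\mathbb P$ indexed by a countable ordinal has a lower bound in $\mathbb P$. If $\langle X,\mathcal T\rangle$ is a topological space in the ground model, then in a forcing extension $X$ is regarded as a space with the topology that has $\mathcal T$ as an open base. A Lindelöf space is indestructible if it remains Lindelöf (in this sense) in every forcing extension by a countably closed forcing notion; a Lindelöf space that is not indestructible is called destructible. *)

theory Defs
  imports "HOL-Analysis.Analysis"
begin

section \<open>Dyadic spaces\<close>

definition Cantor_cube :: "'i set \<Rightarrow> ('i \<Rightarrow> bool) topology" where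
  "Cantor_cube I = product_topology (\<lambda>_. discrete_topology (UNIV :: bool set)) I"

text \<open>The infinite cardinal is represented by an infinite index set \<open>I\<close>. The type of the indices
  is a parameter; a theorem that assumes \<open>dyadic_space TYPE('i) X\<close> for a type variable \<open>'i\<close> covers
  all index sets.\<close>

definition dyadic_space :: "'i itself \<Rightarrow> 'a topology \<Rightarrow> bool" where
  "dyadic_space _ X \<longleftrightarrow> Hausdorff_space X \<and>
     (\<exists>(I :: 'i set) f. infinite I \<and> continuous_map (Cantor_cube I) X f \<and>
        f ` topspace (Cantor_cube I) = topspace X)"

section \<open>Countably closed forcing notions\<close>

text \<open>A forcing notion is a preorder \<open>R\<close> whose conditions are the elements of \<open>Field R\<close>;
  \<open>(p, q) \<in> R\<close> means \<open>p \<le> q\<close>, that is, \<open>p\<close> is stronger than \<open>q\<close>.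

  Every countable ordinal is the order type of a well-order whose field is a set of natural
  numbers. The empty sequence is included, so a countably closed forcing notion is nonempty.\<close>

definition countably_closed :: "'p rel \<Rightarrow> bool" where
  "countably_closed R \<longleftrightarrow>
     (\<forall>(r :: nat rel) s. Well_order r \<and> s ` Field r \<subseteq> Field R \<and>
          (\<forall>(i, j) \<in> r. (s j, s i) \<in> R)
        \<longrightarrow> (\<exists>q \<in> Field R. \<forall>i \<in> Field r. (q, s i) \<in> R))"

section \<open>The forcing relation\<close>

text \<open>A sentence of the forcing language is identified with the set of conditions that force it,
  and the connectives are given by the usual recursive clauses for the forcing relation. With these
  clauses a sentence is forced by \<open>p\<close> iff it is forced by a set of conditions dense below \<open>p\<close>;
  this is why implication needs no double negation.

  A name for a subset of \<open>A\<close> is a set of pairs of a name for an element of \<open>A\<close> and a condition,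
  as usual. Elements \<open>x\<close> of a ground model set are their own names (instead of the
  canonical names \<open>x\<close>-check). In a forcing extension every subset of a ground model set \<open>A\<close>
  therefore has a name of type \<open>('a, 'p) name\<close>, and every set of subsets of \<open>A\<close> has a name of type
  \<open>(('a, 'p) name, 'p) name\<close>. Pairs in a name whose second component is not a condition are
  irrelevant.\<close>

type_synonym 'p sentence = "'p \<Rightarrow> bool"
type_synonym ('x, 'p) name = "('x \<times> 'p) set"

locale forcing =
  fixes R :: "'p rel"
begin

definition dense_below :: "('p \<Rightarrow> bool) \<Rightarrow> 'p \<Rightarrow> bool" where
  "dense_below D p \<longleftrightarrow> (\<forall>q. (q, p) \<in> R \<longrightarrow> (\<exists>r. (r, q) \<in> R \<and> D r))"

definition ground :: "bool \<Rightarrow> 'p sentence" where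
  "ground b = (\<lambda>p. b)"

definition And :: "'p sentence \<Rightarrow> 'p sentence \<Rightarrow> 'p sentence"  (infixr \<open>\<^bold>\<and>\<close> 35) where
  "(\<phi> \<^bold>\<and> \<psi>) = (\<lambda>p. \<phi> p \<and> \<psi> p)"

definition Imp :: "'p sentence \<Rightarrow> 'p sentence \<Rightarrow> 'p sentence"  (infixr \<open>\<^bold>\<longrightarrow>\<close> 25) where
  "(\<phi> \<^bold>\<longrightarrow> \<psi>) = (\<lambda>p. \<forall>q. (q, p) \<in> R \<and> \<phi> q \<longrightarrow> \<psi> q)"

definition Forall :: "('x \<Rightarrow> 'p sentence) \<Rightarrow> 'p sentence"  (binder \<open>\<^bold>\<forall>\<close> 10) where
  "Forall \<Phi> = (\<lambda>p. \<forall>x. \<Phi> x p)"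

definition Exists :: "('x \<Rightarrow> 'p sentence) \<Rightarrow> 'p sentence"  (binder \<open>\<^bold>\<exists>\<close> 10) where
  "Exists \<Phi> = dense_below (\<lambda>q. \<exists>x. \<Phi> x q)"

text \<open>Membership in the set named by \<open>\<tau>\<close>, where \<open>E\<close> is equality for the elements.\<close>

definition mem :: "('x \<Rightarrow> 'x \<Rightarrow> 'p sentence) \<Rightarrow> 'x \<Rightarrow> ('x, 'p) name \<Rightarrow> 'p sentence" where
  "mem E x \<tau> = dense_below (\<lambda>q. \<exists>(y, s) \<in> \<tau>. (q, s) \<in> R \<and> E x y q)"

definition ground_eq :: "'a \<Rightarrow> 'a \<Rightarrow> 'p sentence" where
  "ground_eq x y = ground (x = y)"

abbreviation in_set :: "'a \<Rightarrow> ('a, 'p) name \<Rightarrow> 'p sentence"  (infix \<open>\<^bold>\<in>\<close> 50) where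
  "x \<^bold>\<in> \<sigma> \<equiv> mem ground_eq x \<sigma>"

definition set_eq :: "('a, 'p) name \<Rightarrow> ('a, 'p) name \<Rightarrow> 'p sentence"  (infix \<open>\<^bold>=\<close> 50) where
  "(\<sigma> \<^bold>= \<tau>) = (\<^bold>\<forall>x. (x \<^bold>\<in> \<sigma> \<^bold>\<longrightarrow> x \<^bold>\<in> \<tau>) \<^bold>\<and> (x \<^bold>\<in> \<tau> \<^bold>\<longrightarrow> x \<^bold>\<in> \<sigma>))"

abbreviation in_family :: "('a, 'p) name \<Rightarrow> (('a, 'p) name, 'p) name \<Rightarrow> 'p sentence"
    (infix \<open>\<^bold>\<in>\<^sub>1\<close> 50) where
  "\<sigma> \<^bold>\<in>\<^sub>1 \<U> \<equiv> mem set_eq \<sigma> \<U>"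

definition pair_eq :: "('a, 'p) name \<times> 'b \<Rightarrow> ('a, 'p) name \<times> 'b \<Rightarrow> 'p sentence" where
  "pair_eq = (\<lambda>(\<sigma>, m) (\<tau>, n). \<sigma> \<^bold>= \<tau> \<^bold>\<and> ground (m = n))"

text \<open>A family of sets is countable if some relation \<open>g\<close> between sets and natural numbers relates
  every member of the family to a natural number, and no natural number to distinct sets.\<close>

definition countable_family :: "(('a, 'p) name, 'p) name \<Rightarrow> 'p sentence" where
  "countable_family \<V> =
     (\<^bold>\<exists>g :: (('a, 'p) name \<times> nat, 'p) name.
        (\<^bold>\<forall>\<sigma>. \<sigma> \<^bold>\<in>\<^sub>1 \<V> \<^bold>\<longrightarrow> (\<^bold>\<exists>n. mem pair_eq (\<sigma>, n) g)) \<^bold>\<and>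
        (\<^bold>\<forall>\<sigma> \<tau> n. mem pair_eq (\<sigma>, n) g \<^bold>\<and> mem pair_eq (\<tau>, n) g \<^bold>\<longrightarrow> \<sigma> \<^bold>= \<tau>))"

text \<open>Openness in the topology of the extension that has the ground model topology as a base.\<close>

definition open_set :: "'a topology \<Rightarrow> ('a, 'p) name \<Rightarrow> 'p sentence" where
  "open_set X \<sigma> =
     (\<^bold>\<forall>x. x \<^bold>\<in> \<sigma> \<^bold>\<longrightarrow>
        (\<^bold>\<exists>B. ground (openin X B \<and> x \<in> B) \<^bold>\<and> (\<^bold>\<forall>y. ground (y \<in> B) \<^bold>\<longrightarrow> y \<^bold>\<in> \<sigma>)))"

definition covers :: "'a topology \<Rightarrow> (('a, 'p) name, 'p) name \<Rightarrow> 'p sentence" where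
  "covers X \<U> = (\<^bold>\<forall>x. ground (x \<in> topspace X) \<^bold>\<longrightarrow> (\<^bold>\<exists>\<sigma>. \<sigma> \<^bold>\<in>\<^sub>1 \<U> \<^bold>\<and> x \<^bold>\<in> \<sigma>))"

definition Lindelof :: "'a topology \<Rightarrow> 'p sentence" where
  "Lindelof X =
     (\<^bold>\<forall>\<U>. (\<^bold>\<forall>\<sigma>. \<sigma> \<^bold>\<in>\<^sub>1 \<U> \<^bold>\<longrightarrow> open_set X \<sigma>) \<^bold>\<and> covers X \<U> \<^bold>\<longrightarrow>
        (\<^bold>\<exists>\<V>. countable_family \<V> \<^bold>\<and> (\<^bold>\<forall>\<sigma>. \<sigma> \<^bold>\<in>\<^sub>1 \<V> \<^bold>\<longrightarrow> \<sigma> \<^bold>\<in>\<^sub>1 \<U>) \<^bold>\<and> covers X \<V>))"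

end

section \<open>Indestructible and destructible Lindelof spaces\<close>

text \<open>A sentence holds in every generic extension iff every condition forces it. The parameter
  \<open>'p\<close> is the type of the conditions, since it is not possible to quantify over all types.
  Destructibility for one particular \<open>'p\<close> provides a countably closed forcing notion that
  destroys the space, hence implies destructibility in the unrestricted sense.\<close>

definition indestructible :: "'p itself \<Rightarrow> 'a topology \<Rightarrow> bool" where
  "indestructible _ X \<longleftrightarrow> Lindelof_space X \<and>
     (\<forall>R :: 'p rel. Preorder R \<and> countably_closed R \<longrightarrow>
        (\<forall>p \<in> Field R. forcing.Lindelof R X p))"

definition destructible :: "'p itself \<Rightarrow> 'a topology \<Rightarrow> bool" where
  "destructible T X \<longleftrightarrow> Lindelof_space X \<and> \<not> indestructible T X"

end

theory Submission
  imports Defs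
begin

text \<open>Let \<open>f\<close> map the Cantor cube \<open>2\<^sup>I\<close> onto \<open>X\<close>. Since \<open>X\<close> has more than \<open>2\<^sup>\<omega>\<close> points, \<open>f\<close> does not depend on
  countably many coordinates only, and this yields a basic clopen set \<open>C\<close> of the cube such that \<open>f\<close>
  is not constant on any nonempty \<open>G\<^sub>\<delta>\<close> subset of \<open>C\<close>. Force with the closed \<open>G\<^sub>\<delta>\<close> subsets of \<open>X\<close>
  that meet \<open>f ` C\<close>, ordered by inclusion. By compactness this is countably closed. No condition
  meets \<open>f ` C\<close> in a single point, so every ground model point is avoided by some member of the
  generic filter; hence the complements of these members cover \<open>X\<close>. Countably many of them do not:
  by countable closure a single condition decides them all and is disjoint from their union.\<close>

section \<open>The forcing relation over a preorder\<close>

locale preorder_forcing = forcing R for R :: "'p rel" +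
  assumes Preorder_R: "Preorder R"
begin

lemma refl_R: "p \<in> Field R \<Longrightarrow> (p, p) \<in> R"
  using Preorder_R by (auto simp: preorder_on_def refl_on_def)

lemma trans_R: "(p, q) \<in> R \<Longrightarrow> (q, r) \<in> R \<Longrightarrow> (p, r) \<in> R"
  using Preorder_R by (meson preorder_on_def transD)

lemma dense_below_mono: "dense_below D p \<Longrightarrow> (q, p) \<in> R \<Longrightarrow> dense_below D q"
  unfolding dense_below_def using trans_R by blast

lemma dense_belowE:
  assumes "dense_below D p" "p \<in> Field R"
  obtains r where "(r, p) \<in> R" "D r"
  using assms refl_R unfolding dense_below_def by blast

lemma dense_belowI: "(\<And>q. (q, p) \<in> R \<Longrightarrow> D q) \<Longrightarrow> dense_below D p"
  unfolding dense_below_def by (meson FieldI1 refl_R)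

lemma mem_mono: "mem E x \<tau> p \<Longrightarrow> (q, p) \<in> R \<Longrightarrow> mem E x \<tau> q"
  unfolding mem_def by (rule dense_below_mono)

lemma set_eq_sym: "(\<sigma> \<^bold>= \<tau>) p \<Longrightarrow> (\<tau> \<^bold>= \<sigma>) p"
  unfolding set_eq_def Forall_def And_def Imp_def by blast

lemma set_eq_refl: "(\<sigma> \<^bold>= \<sigma>) p"
  unfolding set_eq_def Forall_def And_def Imp_def by blast

lemma set_eqD: "(\<sigma> \<^bold>= \<tau>) p \<Longrightarrow> (q, p) \<in> R \<Longrightarrow> (x \<^bold>\<in> \<sigma>) q \<Longrightarrow> (x \<^bold>\<in> \<tau>) q"
  unfolding set_eq_def Forall_def And_def Imp_def by blast

text \<open>Unfolds the forcing clauses once, so that later arguments meet only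
  \<open>dense_below\<close> and ordinary quantifiers.\<close>

lemma LindelofD:
  assumes "Lindelof X p" "(q, p) \<in> R"
    and "\<And>\<sigma> r. (r, q) \<in> R \<Longrightarrow> (\<sigma> \<^bold>\<in>\<^sub>1 \<U>) r \<Longrightarrow> open_set X \<sigma> r" "covers X \<U> q"
  shows "dense_below (\<lambda>r. \<exists>\<V>. countable_family \<V> r \<and>
    (\<forall>\<sigma> q. (q, r) \<in> R \<and> (\<sigma> \<^bold>\<in>\<^sub>1 \<V>) q \<longrightarrow> (\<sigma> \<^bold>\<in>\<^sub>1 \<U>) q) \<and> covers X \<V> r) q"
  using assms unfolding Lindelof_def Forall_def Imp_def Exists_def And_def by blast

lemma countable_familyD:
  assumes "countable_family \<V> p"
  shows "dense_below (\<lambda>r. \<exists>g :: (('a, 'p) name \<times> nat, 'p) name.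
    (\<forall>\<sigma> q. (q, r) \<in> R \<and> (\<sigma> \<^bold>\<in>\<^sub>1 \<V>) q \<longrightarrow> dense_below (\<lambda>s. \<exists>n. mem pair_eq (\<sigma>, n) g s) q) \<and>
    (\<forall>\<sigma> \<tau> n q. (q, r) \<in> R \<and> mem pair_eq (\<sigma>, n) g q \<and> mem pair_eq (\<tau>, n) g q \<longrightarrow>
      (\<sigma> \<^bold>= \<tau>) q)) p"
  using assms unfolding countable_family_def Forall_def Imp_def Exists_def And_def by blast

text \<open>The canonical name pairs each element with a greatest condition; a preorder may lack
  one, so all conditions are used.\<close>

definition check_name :: "'a set \<Rightarrow> ('a, 'p) name" where
  "check_name A = A \<times> Field R"

lemma mem_check_name:
  assumes "p \<in> Field R"
  shows "(x \<^bold>\<in> check_name A) p \<longleftrightarrow> x \<in> A"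
proof
  assume "(x \<^bold>\<in> check_name A) p"
  then show "x \<in> A"
    using assms unfolding mem_def check_name_def ground_eq_def ground_def
    by (auto elim: dense_belowE)
next
  assume "x \<in> A"
  then show "(x \<^bold>\<in> check_name A) p"
    unfolding mem_def check_name_def ground_eq_def ground_def
    by (intro dense_belowI) (use FieldI1 refl_R in fastforce)
qed

end

section \<open>Forcing with closed sets\<close>

text \<open>\<open>P_Inter_chain\<close> gives lower bounds for countable descending sequences,
  \<open>P_avoid\<close> the density argument for covering, and \<open>P_nonempty\<close> a point
  that countably many complements miss.\<close>

locale closed_set_forcing = forcing R for R :: "'a set rel" +
  fixes X :: "'a topology" and P :: "'a set set"
  assumes R_def: "R = {(K, L). K \<in> P \<and> L \<in> P \<and> K \<subseteq> L}"
    and P_closedin: "K \<in> P \<Longrightarrow> closedin X K"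
    and P_nonempty: "K \<in> P \<Longrightarrow> K \<noteq> {}"
    and P_Inter_chain: "\<lbrakk>C \<subseteq> P; C \<noteq> {}; countable C; \<And>A B. A \<in> C \<Longrightarrow> B \<in> C \<Longrightarrow> A \<subseteq> B \<or> B \<subseteq> A\<rbrakk>
      \<Longrightarrow> \<Inter>C \<in> P"
    and P_avoid: "K \<in> P \<Longrightarrow> \<exists>L\<in>P. L \<subseteq> K \<and> x \<notin> L"
begin

lemma R_iff: "(K, L) \<in> R \<longleftrightarrow> K \<in> P \<and> L \<in> P \<and> K \<subseteq> L"
  by (simp add: R_def)

lemma Field_R: "Field R = P"
  by (auto simp: R_def Field_def)

lemma Preorder_R: "Preorder R"
  unfolding preorder_on_def Field_R by (auto simp: R_def refl_on_def trans_def)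

sublocale preorder_forcing R
  by unfold_locales (rule Preorder_R)

lemma countably_closed_R:
  assumes "P \<noteq> {}"
  shows "countably_closed R"
  unfolding countably_closed_def
proof (intro allI impI, elim conjE)
  fix r :: "nat rel" and s :: "nat \<Rightarrow> 'a set"
  assume r: "Well_order r" and s: "s ` Field r \<subseteq> Field R" and dec: "\<forall>(i, j)\<in>r. (s j, s i) \<in> R"
  show "\<exists>q\<in>Field R. \<forall>i\<in>Field r. (q, s i) \<in> R"
  proof (cases "Field r = {}")
    case True
    then show ?thesis
      using assms by (auto simp: Field_R)
  next
    case False
    \<comment> \<open>Totality of the well-order makes the values a chain, whose intersection is the
      lower bound.\<close>
    have "s i \<subseteq> s j \<or> s j \<subseteq> s i" if "i \<in> Field r" "j \<in> Field r" for i j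
    proof (cases "i = j")
      case False
      then have "(i, j) \<in> r \<or> (j, i) \<in> r"
        using r that by (auto simp: order_on_defs total_on_def)
      then show ?thesis
        using dec by (auto simp: R_iff)
    qed auto
    then have "\<Inter>(s ` Field r) \<in> P"
      using s False by (intro P_Inter_chain) (auto simp: Field_R)
    then show ?thesis
      using s by (intro bexI[of _ "\<Inter>(s ` Field r)"]) (auto simp: Field_R R_iff)
  qed
qed

text \<open>The name of \<open>{topspace X - K | K \<in> G}\<close> for the generic filter \<open>G\<close>.\<close>

definition complements :: "(('a, 'a set) name, 'a set) name" where
  "complements = (\<lambda>K. (check_name (topspace X - K), K)) ` P"

lemma complementsI:
  assumes "K \<in> P"
  shows "(check_name (topspace X - K) \<^bold>\<in>\<^sub>1 complements) K"
  unfolding mem_def complements_def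
  by (rule dense_belowI) (use assms set_eq_refl in fastforce)

text \<open>Some extension \<open>q\<close> decides which complement \<open>\<sigma>\<close> is, and
  lies below the corresponding \<open>K\<close>.\<close>

lemma complementsE:
  assumes "(\<sigma> \<^bold>\<in>\<^sub>1 complements) p" "p \<in> P"
  obtains q K where "(q, p) \<in> R" "(q, K) \<in> R" "(\<sigma> \<^bold>= check_name (topspace X - K)) q"
  using assms unfolding mem_def complements_def
  by (force elim!: dense_belowE simp: Field_R)

text \<open>Densely often \<open>\<sigma>\<close> equals a ground model open set, which itself
  serves as the neighbourhood \<open>B\<close> of each of its points.\<close>

lemma complements_open:
  assumes "(\<sigma> \<^bold>\<in>\<^sub>1 complements) p"
  shows "open_set X \<sigma> p"
  unfolding open_set_def Forall_def Imp_def Exists_def And_def ground_def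
proof (intro allI impI, elim conjE)
  fix x q
  assume qp: "(q, p) \<in> R" and x: "(x \<^bold>\<in> \<sigma>) q"
  let ?D = "\<lambda>q'. \<exists>B. (openin X B \<and> x \<in> B) \<and> (\<forall>y r. (r, q') \<in> R \<and> y \<in> B \<longrightarrow> (y \<^bold>\<in> \<sigma>) r)"
  show "dense_below ?D q"
    unfolding dense_below_def
  proof (intro allI impI)
    fix q' assume q': "(q', q) \<in> R"
    then have "(\<sigma> \<^bold>\<in>\<^sub>1 complements) q'"
      by (rule mem_mono[OF mem_mono[OF assms qp]])
    then obtain r K where r: "(r, q') \<in> R" "(r, K) \<in> R"
        and eq: "(\<sigma> \<^bold>= check_name (topspace X - K)) r"
      using q' complementsE by (metis R_iff)
    have rP: "r \<in> Field R" "K \<in> P"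
      using r by (auto simp: Field_R R_iff)
    have "(x \<^bold>\<in> check_name (topspace X - K)) r"
      by (rule set_eqD[OF eq refl_R[OF rP(1)] mem_mono[OF mem_mono[OF x q'] r(1)]])
    then have "x \<in> topspace X - K"
      by (simp add: mem_check_name[OF rP(1)])
    moreover have "openin X (topspace X - K)"
      using rP P_closedin by blast
    moreover have "(y \<^bold>\<in> \<sigma>) r'" if "(r', r) \<in> R" "y \<in> topspace X - K" for r' y
      using set_eqD[OF set_eq_sym[OF eq] that(1)] that mem_check_name[of r' y] FieldI1 by metis
    ultimately show "\<exists>r. (r, q') \<in> R \<and> ?D r"
      using r by blast
  qed
qed

text \<open>By \<open>P_avoid\<close> the conditions omitting \<open>x\<close> are dense, and each
  forces its own complement into the family.\<close>

lemma complements_covers: "covers X complements p"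
  unfolding covers_def Forall_def Imp_def Exists_def And_def ground_def
proof (intro allI impI, elim conjE)
  fix x q
  assume "x \<in> topspace X"
  let ?D = "\<lambda>r. \<exists>\<sigma>. (\<sigma> \<^bold>\<in>\<^sub>1 complements) r \<and> (x \<^bold>\<in> \<sigma>) r"
  show "dense_below ?D q"
    unfolding dense_below_def
  proof (intro allI impI)
    fix q' assume "(q', q) \<in> R"
    then obtain L where L: "L \<in> P" "L \<subseteq> q'" "x \<notin> L"
      using P_avoid R_iff by metis
    then have "?D L"
      using \<open>x \<in> topspace X\<close> complementsI mem_check_name[of L x] Field_R by blast
    then show "\<exists>r. (r, q') \<in> R \<and> ?D r"
      using L \<open>(q', q) \<in> R\<close> R_iff by blast
  qed
qed

text \<open>The enumeration \<open>g\<close> exists only in the extension. A descending sequence of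
  conditions therefore decides one index after another; a lower bound \<open>q\<close> lies inside
  every closed set whose complement was decided, so the points of \<open>q\<close> stay
  uncovered.\<close>

lemma not_Lindelof:
  assumes "p \<in> P"
  shows "\<not> Lindelof X p"
proof
  assume Lin: "Lindelof X p"
  have pp: "(p, p) \<in> R"
    using assms R_iff by blast
  obtain p1 \<V> where p1: "(p1, p) \<in> R" and cnt: "countable_family \<V> p1"
    and sub: "\<And>\<sigma> q. (q, p1) \<in> R \<Longrightarrow> (\<sigma> \<^bold>\<in>\<^sub>1 \<V>) q \<Longrightarrow> (\<sigma> \<^bold>\<in>\<^sub>1 complements) q"
    and cov: "covers X \<V> p1"
    using LindelofD[OF Lin pp complements_open complements_covers] assms
    by (auto elim!: dense_belowE simp: Field_R)
  have "p1 \<in> Field R"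
    using p1 FieldI1 by metis
  then obtain p2 and g :: "(('a, 'a set) name \<times> nat, 'a set) name" where p2: "(p2, p1) \<in> R"
    and enum: "\<forall>\<sigma> q. (q, p2) \<in> R \<and> (\<sigma> \<^bold>\<in>\<^sub>1 \<V>) q \<longrightarrow>
      dense_below (\<lambda>r. \<exists>n. mem pair_eq (\<sigma>, n) g r) q"
    and inj: "\<forall>\<sigma> \<tau> n q. (q, p2) \<in> R \<and> mem pair_eq (\<sigma>, n) g q \<and> mem pair_eq (\<tau>, n) g q \<longrightarrow>
      (\<sigma> \<^bold>= \<tau>) q"
    by (rule dense_belowE[OF countable_familyD[OF cnt]]) (elim exE conjE)
  have subD: "(\<sigma> \<^bold>\<in>\<^sub>1 complements) q" if "(q, p2) \<in> R" "(\<sigma> \<^bold>\<in>\<^sub>1 \<V>) q" for q \<sigma>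
    using sub that p2 trans_R by blast
  \<comment> \<open>\<open>good\<close> does not mention \<open>\<V>\<close>: by \<open>inj\<close>
    the index alone determines the set.\<close>
  define hit where "hit n q \<longleftrightarrow> (\<exists>\<sigma>. (\<sigma> \<^bold>\<in>\<^sub>1 \<V>) q \<and> mem pair_eq (\<sigma>, n) g q)" for n q
  define good where "good n q \<longleftrightarrow> (\<exists>\<tau> K. mem pair_eq (\<tau>, n) g q \<and>
      (\<tau> \<^bold>= check_name (topspace X - K)) q \<and> (q, K) \<in> R)" for n q
  have step: "\<exists>q'. (q', q) \<in> R \<and> ((\<exists>r. (r, q) \<in> R \<and> hit n r) \<longrightarrow> good n q')"
    if q: "(q, p2) \<in> R" for q n
  proof (cases "\<exists>r. (r, q) \<in> R \<and> hit n r")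
    case True
    then obtain r \<sigma> where r: "(r, q) \<in> R" "(\<sigma> \<^bold>\<in>\<^sub>1 \<V>) r" "mem pair_eq (\<sigma>, n) g r"
      by (auto simp: hit_def)
    then obtain q' K where q': "(q', r) \<in> R" "(q', K) \<in> R"
      "(\<sigma> \<^bold>= check_name (topspace X - K)) q'"
      using complementsE[OF subD[of r \<sigma>]] trans_R q by (metis R_iff)
    have "mem pair_eq (\<sigma>, n) g q'"
      by (rule mem_mono[OF r(3) q'(1)])
    then have "good n q'"
      unfolding good_def using q' by blast
    then show ?thesis
      using trans_R[OF q'(1) r(1)] by blast
  next
    case False
    then show ?thesis
      using q FieldI1 refl_R by metis
  qed
  \<comment> \<open>Stage \<open>n\<close> decides index \<open>n\<close> unless no extension of
    \<open>Q n\<close> hits it, in which case nothing has to be decided.\<close>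
  have "\<exists>Q. \<forall>n. ((Q n, p2) \<in> R) \<and> ((Q (Suc n), Q n) \<in> R \<and>
      ((\<exists>r. (r, Q n) \<in> R \<and> hit n r) \<longrightarrow> good n (Q (Suc n))))"
  proof (rule dependent_nat_choice)
    show "\<exists>q. (q, p2) \<in> R"
      using p2 refl_R FieldI1 by metis
  next
    fix q n
    assume "(q, p2) \<in> R"
    then show "\<exists>y. (y, p2) \<in> R \<and> (y, q) \<in> R \<and> ((\<exists>r. (r, q) \<in> R \<and> hit n r) \<longrightarrow> good n y)"
      using step trans_R by meson
  qed
  then obtain Q where Q: "\<And>n. (Q n, p2) \<in> R" "\<And>n. (Q (Suc n), Q n) \<in> R"
    and Q_good: "\<And>n r. (r, Q n) \<in> R \<Longrightarrow> hit n r \<Longrightarrow> good n (Q (Suc n))"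
    by blast
  have QP: "Q n \<in> P" for n
    using Q R_iff by blast
  have "decseq Q"
    using Q R_iff by (auto simp: decseq_Suc_iff)
  then have "(\<Inter>n. Q n) \<in> P"
    using QP by (intro P_Inter_chain) (auto simp: decseq_def, metis in_mono nat_le_linear)
  then obtain q where q: "q \<in> P" "\<And>n. q \<subseteq> Q n"
    by blast
  then have qQ: "(q, Q n) \<in> R" for n
    using QP R_iff by blast
  then have qp2: "(q, p2) \<in> R"
    using Q trans_R by blast
  obtain x where x: "x \<in> q"
    using P_nonempty q by blast
  then have "x \<in> topspace X"
    using P_closedin closedin_subset q by blast
  then have "dense_below (\<lambda>r. \<exists>\<sigma>. (\<sigma> \<^bold>\<in>\<^sub>1 \<V>) r \<and> (x \<^bold>\<in> \<sigma>) r) q"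
    using cov qp2 p2 trans_R unfolding covers_def Forall_def Imp_def Exists_def And_def ground_def
    by blast
  then obtain r \<sigma> where r: "(r, q) \<in> R" "(\<sigma> \<^bold>\<in>\<^sub>1 \<V>) r" "(x \<^bold>\<in> \<sigma>) r"
    using q Field_R by (auto elim: dense_belowE)
  then have "(r, p2) \<in> R" "r \<in> Field R"
    using qp2 trans_R FieldI1 by (metis, metis)
  then have "dense_below (\<lambda>s. \<exists>n. mem pair_eq (\<sigma>, n) g s) r"
    using enum r(2) by blast
  with \<open>r \<in> Field R\<close> obtain r2 n where r2: "(r2, r) \<in> R" and n: "mem pair_eq (\<sigma>, n) g r2"
    by (auto elim: dense_belowE)
  have r2q: "(r2, q) \<in> R"
    using r r2 trans_R by blast
  have "hit n r2"
    unfolding hit_def using n mem_mono[OF r(2) r2] by blast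
  then have "good n (Q (Suc n))"
    using Q_good qQ r2q trans_R by blast
  then obtain \<tau> K where \<tau>: "mem pair_eq (\<tau>, n) g (Q (Suc n))"
      "(\<tau> \<^bold>= check_name (topspace X - K)) (Q (Suc n))" and K: "(Q (Suc n), K) \<in> R"
    unfolding good_def by blast
  have r2Q: "(r2, Q (Suc n)) \<in> R"
    using r2q qQ trans_R by blast
  have r2r2: "(r2, r2) \<in> R" "r2 \<in> Field R"
    using r2 refl_R FieldI1 by (metis, metis)
  \<comment> \<open>The set that was to cover \<open>x\<close> is the one decided at stage
    \<open>n\<close>, which misses \<open>q\<close> because
    \<open>q \<subseteq> Q (Suc n) \<subseteq> K\<close>.\<close>
  have "(\<sigma> \<^bold>= \<tau>) r2"
    using inj n mem_mono[OF \<tau>(1) r2Q] trans_R[OF r2q qp2] by blast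
  then have "(x \<^bold>\<in> \<tau>) r2"
    by (rule set_eqD[OF _ r2r2(1) mem_mono[OF r(3) r2]])
  then have "(x \<^bold>\<in> check_name (topspace X - K)) r2"
    by (rule set_eqD[OF \<tau>(2) r2Q])
  then have "x \<notin> K"
    by (simp add: mem_check_name[OF r2r2(2)])
  moreover have "x \<in> K"
    using K x q R_iff by blast
  ultimately show False
    by blast
qed

lemma destructible:
  assumes "Lindelof_space X" "P \<noteq> {}"
  shows "destructible TYPE('a set) X"
  using assms not_Lindelof Preorder_R countably_closed_R Field_R
  unfolding destructible_def indestructible_def by blast

end

section \<open>Continuous images of Cantor cubes\<close>

text \<open>For \<open>z\<close> in the cube and \<open>J \<subseteq> I\<close>, finite
  \<open>J\<close> give the basic clopen neighbourhoods of \<open>z\<close>, and countable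
  \<open>J\<close> give closed G_delta sets.\<close>

definition cylinder :: "'i set \<Rightarrow> ('i \<Rightarrow> bool) \<Rightarrow> 'i set \<Rightarrow> ('i \<Rightarrow> bool) set" where
  "cylinder I z J = {w \<in> topspace (Cantor_cube I). \<forall>i\<in>J. w i = z i}"

lemma topspace_Cantor_cube: "topspace (Cantor_cube I) = I \<rightarrow>\<^sub>E UNIV"
  by (simp add: Cantor_cube_def)

lemma compact_space_Cantor_cube: "compact_space (Cantor_cube I)"
  unfolding Cantor_cube_def compact_space_product_topology
  by (simp add: compact_space_discrete_topology)

lemma cylinder_antimono: "J \<subseteq> J' \<Longrightarrow> cylinder I z J' \<subseteq> cylinder I z J"
  by (auto simp: cylinder_def)

lemma cylinder_self: "z \<in> topspace (Cantor_cube I) \<Longrightarrow> z \<in> cylinder I z J"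
  by (simp add: cylinder_def)

lemma open_Cantor_cube_contains_cylinder:
  assumes "openin (Cantor_cube I) U" "z \<in> U"
  obtains F where "finite F" "F \<subseteq> I" "cylinder I z F \<subseteq> U"
proof -
  obtain V where V: "finite {i \<in> I. V i \<noteq> UNIV}" "z \<in> Pi\<^sub>E I V" "Pi\<^sub>E I V \<subseteq> U"
    using assms unfolding Cantor_cube_def openin_product_topology_alt by fastforce
  have "cylinder I z {i \<in> I. V i \<noteq> UNIV} \<subseteq> Pi\<^sub>E I V"
  proof
    fix w assume w: "w \<in> cylinder I z {i \<in> I. V i \<noteq> UNIV}"
    have "w i \<in> V i" if "i \<in> I" for i
    proof (cases "V i = UNIV")
      case False
      then have "w i = z i"
        using w that by (simp add: cylinder_def)
      then show ?thesis
        using V(2) that by (simp add: PiE_iff)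
    qed simp
    then show "w \<in> Pi\<^sub>E I V"
      using w by (simp add: cylinder_def topspace_Cantor_cube PiE_iff)
  qed
  then show thesis
    using that[of "{i \<in> I. V i \<noteq> UNIV}"] V by auto
qed

text \<open>Each of the countably many open sets with intersection \<open>K\<close> needs only
  finitely many coordinates around \<open>z\<close>.\<close>

lemma gdelta_preimage_contains_cylinder:
  assumes f: "continuous_map (Cantor_cube I) X f" and K: "gdelta_in X K"
    and z: "z \<in> topspace (Cantor_cube I)" "f z \<in> K"
  obtains J where "countable J" "J \<subseteq> I" "f ` cylinder I z J \<subseteq> K"
proof -
  obtain U :: "nat \<Rightarrow> 'b set" where U: "\<And>n. openin X (U n)" "K = (\<Inter>n. U n)"
    using K by (auto simp: gdelta_in_descending)
  have "\<exists>F. finite F \<and> F \<subseteq> I \<and> f ` cylinder I z F \<subseteq> U n" for n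
  proof -
    have "openin (Cantor_cube I) {w \<in> topspace (Cantor_cube I). f w \<in> U n}"
      using f U(1) by (rule openin_continuous_map_preimage)
    moreover have "z \<in> {w \<in> topspace (Cantor_cube I). f w \<in> U n}"
      using z U by auto
    ultimately show ?thesis
      by (elim open_Cantor_cube_contains_cylinder) blast+
  qed
  then obtain F where F: "\<And>n. finite (F n)" "\<And>n. F n \<subseteq> I" "\<And>n. f ` cylinder I z (F n) \<subseteq> U n"
    by metis
  have "f ` cylinder I z (\<Union>n. F n) \<subseteq> U n" for n
    using F(3)[of n] cylinder_antimono[of "F n" "\<Union>n. F n" I z] by blast
  then have "f ` cylinder I z (\<Union>n. F n) \<subseteq> K"
    unfolding U(2) by (rule INT_greatest)
  moreover have "countable (\<Union>n. F n)"
    using F(1) by (intro countable_UN[OF _ countable_finite]) auto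
  ultimately show thesis
    using F(2) by (intro that[of "\<Union>n. F n"]) auto
qed

lemma countable_closure_under_finite_subsets:
  assumes h: "\<And>F. finite F \<Longrightarrow> F \<subseteq> I \<Longrightarrow> countable (h F) \<and> h F \<subseteq> I"
  shows "\<exists>J. countable J \<and> J \<subseteq> I \<and> (\<forall>F. finite F \<and> F \<subseteq> J \<longrightarrow> h F \<subseteq> J)"
proof -
  \<comment> \<open>Countably many stages suffice: they increase, so a finite subset of their union
    lies in one stage, and the next stage absorbs its value under \<open>h\<close>.\<close>
  define T where "T n = ((\<lambda>J. J \<union> \<Union>(h ` {F. finite F \<and> F \<subseteq> J})) ^^ n) {}" for n
  have T_Suc: "T (Suc n) = T n \<union> \<Union>(h ` {F. finite F \<and> F \<subseteq> T n})" for n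
    by (simp add: T_def)
  have T: "countable (T n) \<and> T n \<subseteq> I" for n
  proof (induction n)
    case 0
    then show ?case by (simp add: T_def)
  next
    case (Suc n)
    have "countable (h F) \<and> h F \<subseteq> I" if "finite F" "F \<subseteq> T n" for F
      using Suc that by (intro h) auto
    then have "countable (\<Union>(h ` {F. finite F \<and> F \<subseteq> T n}))" "\<Union>(h ` {F. finite F \<and> F \<subseteq> T n}) \<subseteq> I"
      using Suc countable_Collect_finite_subset[of "T n"] by (auto intro: countable_UN)
    then show ?case
      unfolding T_Suc using Suc by simp
  qed
  have mono: "T m \<subseteq> T n" if "m \<le> n" for m n
    using that by (rule lift_Suc_mono_le[rotated]) (auto simp: T_Suc)
  show ?thesis
  proof (intro exI[of _ "\<Union>n. T n"] conjI allI impI)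
    show "countable (\<Union>n. T n)" "(\<Union>n. T n) \<subseteq> I"
      using T by auto
    fix F assume F: "finite F \<and> F \<subseteq> (\<Union>n. T n)"
    then obtain n where "F \<subseteq> T n"
      using finite_subset_Union_chain[of F "range T"] mono
      by (smt (verit, best) UNIV_I UNIV_not_empty image_iff image_is_empty nat_le_linear subset_chain_def subsetI)
    then show "h F \<subseteq> (\<Union>n. T n)"
      using F T_Suc[of n] by blast
  qed
qed

text \<open>If no such cylinder exists, closing off under choices of cylinders on which \<open>f\<close> is constant
  yields a countable \<open>J\<close> such that \<open>f\<close> depends only on the coordinates in \<open>J\<close>: points
  \<open>z\<close> and \<open>w\<close> agreeing on \<open>J\<close> with \<open>f z \<noteq> f w\<close> would have disjoint basic neighbourhoods that meet
  a common cylinder of constancy.\<close>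

lemma nowhere_constant_cylinder:
  fixes X :: "'a topology" and I :: "'i set"
  assumes haus: "Hausdorff_space X" and f: "continuous_map (Cantor_cube I) X f"
    and onto: "f ` topspace (Cantor_cube I) = topspace X"
    and big: "(UNIV :: nat set set) \<prec> topspace X"
  obtains z0 F where "z0 \<in> topspace (Cantor_cube I)" "finite F" "F \<subseteq> I"
    "\<And>z J. \<lbrakk>z \<in> cylinder I z0 F; countable J; J \<subseteq> I\<rbrakk>
      \<Longrightarrow> \<exists>w \<in> cylinder I z0 F \<inter> cylinder I z J. f w \<noteq> f z"
proof (rule ccontr)
  note found = that
  assume neg: "\<not> thesis"
  let ?T = "topspace (Cantor_cube I)"
  have "\<exists>z J. z \<in> cylinder I z0 F \<and> countable J \<and> J \<subseteq> I \<and>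
      (\<forall>w \<in> cylinder I z0 F \<inter> cylinder I z J. f w = f z)"
    if "z0 \<in> ?T" "finite F" "F \<subseteq> I" for z0 F
  proof (rule ccontr)
    assume "\<not> ?thesis"
    then have thesis
      by (intro found[OF that]) blast
    with neg show False ..
  qed
  \<comment> \<open>Inside \<open>cylinder I z0 F\<close>, \<open>f\<close> is constant on the
    cylinder with centre \<open>Z z0 F\<close> and countable support \<open>H z0 F\<close>.\<close>
  then obtain Z H where ZH: "\<And>z0 F. \<lbrakk>z0 \<in> ?T; finite F; F \<subseteq> I\<rbrakk> \<Longrightarrow>
      Z z0 F \<in> cylinder I z0 F \<and> countable (H z0 F) \<and> H z0 F \<subseteq> I \<and>
      (\<forall>w \<in> cylinder I z0 F \<inter> cylinder I (Z z0 F) (H z0 F). f w = f (Z z0 F))"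
    by metis
  \<comment> \<open>The indicators \<open>e A\<close> with \<open>A \<subseteq> F\<close> realise
    all patterns on a finite \<open>F \<subseteq> I\<close>, so \<open>h F\<close> below collects
    the supports of finitely many cylinders.\<close>
  define e where "e A = restrict (\<lambda>i. i \<in> A) I" for A
  have e: "e A \<in> ?T" for A
    by (simp add: e_def topspace_Cantor_cube)
  define h where "h F = (\<Union>A\<in>Pow F. H (e A) F)" for F
  have h: "countable (h F) \<and> h F \<subseteq> I"
    if "finite F" "F \<subseteq> I" for F
  proof -
    have "countable (Pow F)"
      using that by (simp add: countable_finite)
    moreover have "countable (H (e A) F)" "H (e A) F \<subseteq> I" for A
      using ZH[OF e that] by auto
    ultimately show ?thesis
      unfolding h_def by auto
  qed
  have "\<exists>J. countable J \<and> J \<subseteq> I \<and> (\<forall>F. finite F \<and> F \<subseteq> J \<longrightarrow> h F \<subseteq> J)"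
    by (rule countable_closure_under_finite_subsets) (rule h)
  then obtain J where J: "countable J" "J \<subseteq> I"
    and closed: "\<forall>F. finite F \<and> F \<subseteq> J \<longrightarrow> h F \<subseteq> J"
    by (elim exE conjE)
  have dep: "f z = f w" if z: "z \<in> ?T" and w: "w \<in> ?T" and zw: "\<forall>i\<in>J. z i = w i" for z w
  proof (rule ccontr)
    assume "f z \<noteq> f w"
    moreover have "f z \<in> topspace X" "f w \<in> topspace X"
      using z w onto by auto
    ultimately obtain U V where UV: "openin X U" "openin X V" "f z \<in> U" "f w \<in> V" "disjnt U V"
      using haus unfolding Hausdorff_space_def by metis
    obtain Fz where Fz: "finite Fz" "Fz \<subseteq> I" "cylinder I z Fz \<subseteq> {u \<in> ?T. f u \<in> U}"
      using open_Cantor_cube_contains_cylinder[OF openin_continuous_map_preimage[OF f UV(1)]] z UV(3)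
      by blast
    obtain Fw where Fw: "finite Fw" "Fw \<subseteq> I" "cylinder I w Fw \<subseteq> {u \<in> ?T. f u \<in> V}"
      using open_Cantor_cube_contains_cylinder[OF openin_continuous_map_preimage[OF f UV(2)]] w UV(4)
      by blast
    \<comment> \<open>\<open>z\<close> and \<open>w\<close> agree on \<open>J\<close>, so
      \<open>A\<close> records their common pattern on the coordinates in \<open>J\<close> that
      either neighbourhood restricts.\<close>
    define F where "F = (Fz \<union> Fw) \<inter> J"
    define A where "A = {i \<in> F. z i}"
    have F: "finite F" "F \<subseteq> J" "F \<subseteq> I" "A \<in> Pow F"
      using Fz Fw J by (auto simp: F_def A_def)
    define c where "c = Z (e A) F"
    define L where "L = H (e A) F"
    have L: "L \<subseteq> J"
      using closed[rule_format, of F] F by (auto simp: L_def h_def)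
    have c: "c \<in> cylinder I (e A) F"
      and const: "\<And>u. u \<in> cylinder I (e A) F \<Longrightarrow> u \<in> cylinder I c L \<Longrightarrow> f u = f c"
      using ZH[OF e F(1,3)] unfolding c_def L_def by blast+
    have eA: "e A i = z i" if "i \<in> F" for i
      using that F by (auto simp: e_def A_def)
    have meets: "f c \<in> W" if G: "G \<subseteq> I" "G \<inter> J \<subseteq> F" and v: "v \<in> ?T" "\<forall>i\<in>J. z i = v i"
      and W: "cylinder I v G \<subseteq> {u \<in> ?T. f u \<in> W}" for v G W
    proof -
      \<comment> \<open>Gluing with \<open>c\<close> on \<open>L \<union> F\<close> keeps
        \<open>u\<close> in the cylinder of constancy. On \<open>G\<close> it agrees with
        \<open>v\<close>, because \<open>L \<subseteq> J\<close>,
        \<open>G \<inter> J \<subseteq> F\<close>, and on \<open>F\<close> both \<open>c\<close> and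
        \<open>v\<close> agree with \<open>z\<close>.\<close>
      define u where "u = (\<lambda>i. if i \<in> L \<union> F then c i else v i)"
      have cT: "c \<in> ?T" and cF: "\<And>i. i \<in> F \<Longrightarrow> c i = z i"
        using c eA by (auto simp: cylinder_def)
      have uT: "u \<in> ?T"
        using cT v(1) L J F by (auto simp: u_def topspace_Cantor_cube PiE_iff extensional_def)
      have "u \<in> cylinder I (e A) F" "u \<in> cylinder I c L"
        using uT c by (auto simp: cylinder_def u_def)
      then have "f u = f c"
        by (rule const)
      moreover have "u i = v i" if "i \<in> G" for i
      proof (cases "i \<in> J")
        case True
        then have "i \<in> F"
          using that G by blast
        then show ?thesis
          using True v(2) cF by (auto simp: u_def)
      next
        case False
        then show ?thesis
          using L F(2) by (auto simp: u_def)
      qed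
      then have "u \<in> cylinder I v G"
        using uT by (simp add: cylinder_def)
      ultimately show ?thesis
        using W by auto
    qed
    have "f c \<in> U"
      by (rule meets[OF Fz(2) _ z _ Fz(3)]) (auto simp: F_def)
    moreover have "f c \<in> V"
      by (rule meets[OF Fw(2) _ w zw Fw(3)]) (auto simp: F_def)
    ultimately show False
      using UV(5) by (auto simp: disjnt_def)
  qed
  \<comment> \<open>Replacing \<open>z\<close> by the indicator of its trace on \<open>J\<close>
    leaves \<open>f z\<close> unchanged, so \<open>X\<close> has at most as many points as
    \<open>J\<close> has subsets.\<close>
  have "topspace X \<subseteq> (\<lambda>A. f (e A)) ` Pow J"
  proof
    fix x assume "x \<in> topspace X"
    then obtain z where z: "z \<in> ?T" "x = f z"
      using onto by blast
    have "f z = f (e {i \<in> J. z i})"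
      using J by (intro dep z e) (auto simp: e_def)
    then show "x \<in> (\<lambda>A. f (e A)) ` Pow J"
      using z by blast
  qed
  then have "topspace X \<lesssim> Pow J"
    by (meson image_lepoll lepoll_trans subset_imp_lepoll)
  also have "Pow J \<lesssim> (UNIV :: nat set set)"
  proof -
    have "inj_on (image (to_nat_on J)) (Pow J)"
      using J(1) inj_on_image_Pow inj_on_to_nat_on by blast
    then show ?thesis
      by (auto simp: lepoll_def)
  qed
  finally show False
    using big by (meson lepoll_antisym lesspoll_def)
qed

text \<open>Intersecting with such a set shrinks a condition away from a point while it stays closed
  and G_delta.\<close>

lemma gdelta_zero_set:
  assumes "continuous_map X euclideanreal g"
  shows "gdelta_in X {x \<in> topspace X. g x = 0}" "closedin X {x \<in> topspace X. g x = 0}"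
proof -
  have eq: "{x \<in> topspace X. g x = 0} =
      (\<Inter>n::nat. {x \<in> topspace X. g x \<in> {- inverse (Suc n)<..<inverse (Suc n)}})"
  proof -
    have "g x = 0" if *: "\<forall>n::nat. g x \<in> {- inverse (Suc n)<..<inverse (Suc n)}" for x
    proof (rule ccontr)
      assume "g x \<noteq> 0"
      then obtain n where "inverse (Suc n) < \<bar>g x\<bar>"
        using reals_Archimedean[of "\<bar>g x\<bar>"] by auto
      then show False
        using *[rule_format, of n] by auto
    qed
    then show ?thesis
      by auto
  qed
  show "gdelta_in X {x \<in> topspace X. g x = 0}"
    unfolding eq
    by (intro gdelta_in_Inter) (auto simp del: greaterThanLessThan_iff
        intro!: open_imp_gdelta_in openin_continuous_map_preimage[OF assms])
  show "closedin X {x \<in> topspace X. g x = 0}"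
    using closedin_continuous_map_preimage[OF assms, of "{0}"] by simp
qed

text \<open>The intersection is the least member. Finite subfamilies of a chain of conditions thus
  have conditions as intersections, as the compactness argument requires.\<close>

lemma finite_chain_Inter_mem:
  assumes "finite C" "C \<noteq> {}" "\<And>A B. A \<in> C \<Longrightarrow> B \<in> C \<Longrightarrow> A \<subseteq> B \<or> B \<subseteq> A"
  shows "\<Inter>C \<in> C"
  using assms
proof (induction C rule: finite_ne_induct)
  case (insert A C)
  then have "\<Inter>C \<in> C" by blast
  then show ?case
    using insert.prems[of A "\<Inter>C"] by (auto simp: inf.absorb1 inf.absorb2)
qed simp

section \<open>Destructibility of large dyadic spaces\<close>

theorem theorem1p11:
  fixes X :: "'a topology"
  assumes "dyadic_space TYPE('i) X"
    and "(UNIV :: nat set set) \<prec> topspace X"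
  shows "destructible TYPE('a set) X"
proof -
  obtain I :: "'i set" and f where haus: "Hausdorff_space X"
    and f: "continuous_map (Cantor_cube I) X f"
    and onto: "f ` topspace (Cantor_cube I) = topspace X"
    using assms(1) by (auto simp: dyadic_space_def)
  have compact: "compact_space X"
    using image_compactin[OF _ f] compact_space_Cantor_cube[of I] onto
    by (metis compact_space_def)
  obtain z0 F where z0: "z0 \<in> topspace (Cantor_cube I)" "finite F" "F \<subseteq> I"
    and nonconst: "\<And>z J. \<lbrakk>z \<in> cylinder I z0 F; countable J; J \<subseteq> I\<rbrakk>
      \<Longrightarrow> \<exists>w \<in> cylinder I z0 F \<inter> cylinder I z J. f w \<noteq> f z"
    using nowhere_constant_cylinder[OF haus f onto assms(2)] by blast
  define S where "S = f ` cylinder I z0 F"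
  \<comment> \<open>Being G_delta ensures that a condition contains the image of a cylinder with
    countable support, on which \<open>f\<close> takes several values in \<open>S\<close>.\<close>
  define P where "P = {K. closedin X K \<and> gdelta_in X K \<and> S \<inter> K \<noteq> {}}"
  have "closedin (Cantor_cube I) (cylinder I z0 F)"
  proof -
    have "closedin (Cantor_cube I) {w \<in> topspace (Cantor_cube I). w i = z0 i}" if "i \<in> F" for i
    proof -
      have "continuous_map (Cantor_cube I) (discrete_topology UNIV) (\<lambda>w. w i)"
        unfolding Cantor_cube_def using that z0 by (intro continuous_map_product_projection) auto
      from closedin_continuous_map_preimage[OF this, of "{z0 i}"] show ?thesis
        by simp
    qed
    then have "closedin (Cantor_cube I) (topspace (Cantor_cube I) \<inter>
        (\<Inter>i\<in>F. {w \<in> topspace (Cantor_cube I). w i = z0 i}))"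
      by (cases "F = {}") (auto intro!: closedin_Int closedin_INT)
    moreover have "topspace (Cantor_cube I) \<inter>
        (\<Inter>i\<in>F. {w \<in> topspace (Cantor_cube I). w i = z0 i}) = cylinder I z0 F"
      by (auto simp: cylinder_def)
    ultimately show ?thesis by simp
  qed
  then have "compactin X S"
    unfolding S_def using image_compactin[OF _ f] closedin_compact_space compact_space_Cantor_cube
    by blast
  interpret closed_set_forcing "{(K, L). K \<in> P \<and> L \<in> P \<and> K \<subseteq> L}" X P
  proof
    fix C assume C: "C \<subseteq> P" "C \<noteq> {}" "countable C"
      and chain: "\<And>A B. A \<in> C \<Longrightarrow> B \<in> C \<Longrightarrow> A \<subseteq> B \<or> B \<subseteq> A"
    \<comment> \<open>Compactness of \<open>S\<close> reduces the claim to finite subfamilies. The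
      empty one has intersection \<open>UNIV\<close>, so there \<open>S\<close> must be
      nonempty.\<close>
    have "S \<inter> \<Inter>G \<noteq> {}" if "finite G" "G \<subseteq> C" for G
    proof (cases "G = {}")
      case True
      then show ?thesis
        using z0 cylinder_self by (fastforce simp: S_def)
    next
      case False
      then have "\<Inter>G \<in> P"
        using finite_chain_Inter_mem[of G] that chain C by blast
      then show ?thesis
        by (simp add: P_def)
    qed
    then have "S \<inter> \<Inter>C \<noteq> {}"
      using \<open>compactin X S\<close>[unfolded compactin_fip, THEN conjunct2, rule_format, of C] C(1)
        P_def by blast
    moreover have "closedin X (\<Inter>C)" "gdelta_in X (\<Inter>C)"
      using C by (auto simp: P_def intro!: closedin_Inter gdelta_in_Inter)
    ultimately show "\<Inter>C \<in> P"
      by (simp add: P_def)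
  next
    fix K x assume K: "K \<in> P"
    then obtain z where z: "z \<in> cylinder I z0 F" "f z \<in> K"
      by (auto simp: P_def S_def)
    then have "z \<in> topspace (Cantor_cube I)"
      by (simp add: cylinder_def)
    then obtain J where J: "countable J" "J \<subseteq> I" "f ` cylinder I z J \<subseteq> K"
      using gdelta_preimage_contains_cylinder[OF f] K z(2) unfolding P_def by blast
    then obtain w where w: "w \<in> cylinder I z0 F" "f w \<in> K" "f w \<noteq> f z"
      using nonconst[OF z(1) J(1,2)] by blast
    \<comment> \<open>\<open>f z\<close> and \<open>f w\<close> are distinct points of
      \<open>S \<inter> K\<close>, so one of them differs from \<open>x\<close>.\<close>
    then obtain y where y: "y \<in> S" "y \<in> K" "y \<noteq> x"
      using z unfolding S_def by blast
    have yX: "y \<in> topspace X"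
      using K y closedin_subset by (auto simp: P_def)
    show "\<exists>L\<in>P. L \<subseteq> K \<and> x \<notin> L"
    proof (cases "x \<in> topspace X")
      case True
      have "completely_regular_space X"
        using compact haus compact_Hausdorff_or_regular_imp_normal_space
          normal_imp_completely_regular_space by blast
      moreover have "closedin X {x}"
        using haus True closedin_Hausdorff_sing_eq by metis
      \<comment> \<open>The zero set of this Urysohn function keeps \<open>y\<close>, hence still
        meets \<open>S\<close>, and drops \<open>x\<close>.\<close>
      ultimately obtain g :: "'a \<Rightarrow> real" where "continuous_map X (top_of_set {0..1}) g"
        "g y = 0" "g ` {x} \<subseteq> {1}"
        using y yX unfolding completely_regular_space_def by (metis Diff_iff singletonD)
      then have g: "continuous_map X euclideanreal g" "g y = 0" "g x = 1"
        by (auto simp: continuous_map_in_subtopology)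
      let ?L = "K \<inter> {x \<in> topspace X. g x = 0}"
      have "?L \<in> P"
        using K y yX g(2) gdelta_zero_set[OF g(1)]
        by (auto simp: P_def intro!: closedin_Int gdelta_in_Int)
      then show ?thesis
        using g(3) by (intro bexI[of _ ?L]) auto
    next
      case False
      then show ?thesis
        using K closedin_subset[of X K] by (intro bexI[of _ K]) (auto simp: P_def)
    qed
  qed (auto simp: P_def)
  \<comment> \<open>The whole space is a condition, so the forcing notion is nonempty.\<close>
  have "topspace X \<in> P"
    using cylinder_self[OF z0(1)] z0(1) onto by (fastforce simp: P_def S_def cylinder_def)
  then show ?thesis
    using destructible compact compact_imp_Lindelof_space by blast
qed

end
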